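(* Let $\Delta\subset\mathbb{Z}$ be a bounded, co-bounded $(m,n)$-invariant set. Let $c_0<c_1<\dots<c_{n-1}$ be the $n$-cogenerators of $\Delta$, and let $\mathcal{G}(\Delta)$ be the lattice path obtained by listing the skeleton of $\Delta$ in increasing order and, starting from the point $(n,0)$, replacing each $m$-generator of $\Delta$ by a unit up step and each $n$-cogenerator by a unit left step (so the path ends at $(0,m)$). For $0\le i\le n-1$ let $p_i$ be the height (the $y$-coordinate) of the horizontal step of $\mathcal{G}(\Delta)$ corresponding to $c_i$, i.e. the number of $m$-generators of $\Delta$ that are smaller than $c_i$. Then the word $\mathbf{p}=p_{n-1}\dots p_1p_0$ (the column heights of $\mathcal{G}(\Delta)$ read from left to right) is the unique monotone $(m,n)$-parking function such that $\mathbf{p}\cdot\Delta=\Delta+n$.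
   Context: $[m]=\{0,\dots,m-1\}$. A set $\Delta\subset\mathbb{Z}$ is $k$-invariant if $\Delta+k\subset\Delta$, and $(m,n)$-invariant if it is both $m$- and $n$-invariant; bounded means it has a minimum, co-bounded means $\mathbb{Z}_{\ge K}\subset\Delta$ for some $K$. An element $a\in\Delta$ is an $k$-generator if $a-k\notin\Delta$; an element $a\notin\Delta$ is a $k$-cogenerator if $a+k\in\Delta$. The skeleton of an $(m,n)$-invariant set is the union of its $m$-generators and its $n$-cogenerators. If $a_0<\dots<a_{m-1}$ are the $m$-generators of $\Delta$, a letter $j\in[m]$ acts by $j\cdot\Delta=\Delta\setminus\{a_j\}$, and a word $\mathbf{w}=w_{n-1}\dots w_0\in[m]^n$ acts right to left: $\mathbf{w}\cdot\Delta=w_{n-1}\cdot(\cdots(w_0\cdot\Delta))$. An $(m,n)$-parking function is a word $\mathbf{w}=w_{n-1}\dots w_0\in[m]^n$ with $\#\{j:w_j<i\}\ge in/m$ for $1\le i\le m$; it is monotone if $w_0\le w_1\le\dots\le w_{n-1}$. *)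

theory Defs
  imports Complex_Main
begin

definition shift :: "nat \<Rightarrow> int set \<Rightarrow> int set" where
  "shift k \<Delta> = (\<lambda>x. x + int k) ` \<Delta>"

definition invariant :: "nat \<Rightarrow> int set \<Rightarrow> bool" where
  "invariant k \<Delta> \<longleftrightarrow> shift k \<Delta> \<subseteq> \<Delta>"

definition has_minimum :: "int set \<Rightarrow> bool" where
  "has_minimum \<Delta> \<longleftrightarrow> (\<exists>a\<in>\<Delta>. \<forall>x\<in>\<Delta>. a \<le> x)"

definition cobounded :: "int set \<Rightarrow> bool" where
  "cobounded \<Delta> \<longleftrightarrow> (\<exists>K. {K..} \<subseteq> \<Delta>)"

definition generators :: "nat \<Rightarrow> int set \<Rightarrow> int set" where
  "generators k \<Delta> = {a. a \<in> \<Delta> \<and> a - int k \<notin> \<Delta>}"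

definition cogenerators :: "nat \<Rightarrow> int set \<Rightarrow> int set" where
  "cogenerators k \<Delta> = {a. a \<notin> \<Delta> \<and> a + int k \<in> \<Delta>}"

definition skeleton :: "nat \<Rightarrow> nat \<Rightarrow> int set \<Rightarrow> int set" where
  "skeleton m n \<Delta> = generators m \<Delta> \<union> cogenerators n \<Delta>"

text \<open>
  The increasing enumerations below use \<open>sorted_list_of_set\<close>, which is the empty list for an
  infinite set. For a bounded, co-bounded set that is \<open>k\<close>-invariant with \<open>k > 0\<close>, the sets of
  \<open>k\<close>-generators and \<open>k\<close>-cogenerators are finite (one element per residue class).
\<close>

definition generator_list :: "nat \<Rightarrow> int set \<Rightarrow> int list" where
  "generator_list m \<Delta> = sorted_list_of_set (generators m \<Delta>)"

definition cogenerator_list :: "nat \<Rightarrow> int set \<Rightarrow> int list" where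
  "cogenerator_list n \<Delta> = sorted_list_of_set (cogenerators n \<Delta>)"

definition skeleton_list :: "nat \<Rightarrow> nat \<Rightarrow> int set \<Rightarrow> int list" where
  "skeleton_list m n \<Delta> = sorted_list_of_set (skeleton m n \<Delta>)"

text \<open>
  A word \<open>w\<^sub>n\<^sub>-\<^sub>1 \<dots> w\<^sub>0\<close> is the list of its letters in reading order, so \<open>w\<^sub>j\<close> is \<open>rev w ! j\<close>, and
  acting from right to left is \<^const>\<open>foldr\<close>.
\<close>

definition letter_act :: "nat \<Rightarrow> nat \<Rightarrow> int set \<Rightarrow> int set" where
  "letter_act m j \<Delta> = \<Delta> - {generator_list m \<Delta> ! j}"

definition word_act :: "nat \<Rightarrow> nat list \<Rightarrow> int set \<Rightarrow> int set" where
  "word_act m w \<Delta> = foldr (letter_act m) w \<Delta>"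

definition parking_function :: "nat \<Rightarrow> nat \<Rightarrow> nat list \<Rightarrow> bool" where
  "parking_function m n w \<longleftrightarrow>
     length w = n \<and> set w \<subseteq> {..<m} \<and>
     (\<forall>i\<in>{1..m}. real (card {j. j < n \<and> rev w ! j < i}) \<ge> real i * real n / real m)"

definition monotone_word :: "nat list \<Rightarrow> bool" where
  "monotone_word w \<longleftrightarrow> sorted (rev w)"

datatype step = Up | Left

text \<open>
  The vertices of a lattice path. The \<open>x\<close>-coordinate is an integer so that left steps
  are not truncated at \<open>0\<close>.
\<close>

fun path_vertices :: "int \<times> nat \<Rightarrow> step list \<Rightarrow> (int \<times> nat) list" where
  "path_vertices P [] = [P]"
| "path_vertices (x, y) (Up # ss) = (x, y) # path_vertices (x, y + 1) ss"
| "path_vertices (x, y) (Left # ss) = (x, y) # path_vertices (x - 1, y) ss"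

definition skeleton_path :: "nat \<Rightarrow> nat \<Rightarrow> int set \<Rightarrow> (int \<times> nat) list" where
  "skeleton_path m n \<Delta> =
     path_vertices (int n, 0)
       (map (\<lambda>s. if s \<in> generators m \<Delta> then Up else Left) (skeleton_list m n \<Delta>))"

text \<open>
  The step of the path replacing the \<open>k\<close>-th skeleton element (counting from \<open>0\<close>)
  joins vertices \<open>k\<close> and \<open>k + 1\<close>; if it is horizontal, its height is the second coordinate of
  either of them.
\<close>

definition step_height :: "nat \<Rightarrow> nat \<Rightarrow> int set \<Rightarrow> int \<Rightarrow> nat" where
  "step_height m n \<Delta> c =
     snd (skeleton_path m n \<Delta> !
       (THE k. k < length (skeleton_list m n \<Delta>) \<and> skeleton_list m n \<Delta> ! k = c))"

definition height_word :: "nat \<Rightarrow> nat \<Rightarrow> int set \<Rightarrow> nat list" where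
  "height_word m n \<Delta> = rev (map (step_height m n \<Delta>) (cogenerator_list n \<Delta>))"

text \<open>
  The path \<open>P\<close> crosses the column between abscissae \<open>x\<close> and \<open>x + 1\<close>
  by a left step at height \<open>y\<close>.
\<close>

definition column_height :: "(int \<times> nat) list \<Rightarrow> nat \<Rightarrow> nat \<Rightarrow> bool" where
  "column_height P x y \<longleftrightarrow>
     (\<exists>k. Suc k < length P \<and> P ! k = (int x + 1, y) \<and> P ! Suc k = (int x, y))"

end

theory Submission imports Defs begin

text \<open>
  Acting by \<open>p\<close> removes \<open>c\<^sub>0 + n, c\<^sub>1 + n, \<dots>\<close> in this order: once
  \<open>c\<^sub>0 + n, \<dots>, c\<^sub>i\<^sub>-\<^sub>1 + n\<close> are gone, the set agrees with
  \<open>\<Delta> + n\<close> below \<open>c\<^sub>i + n\<close>, so \<open>c\<^sub>i + n\<close> is an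
  \<open>m\<close>-generator and exactly \<open>p\<^sub>i\<close> of the \<open>m\<close>-generators are smaller.
  A monotone word removes elements in increasing order, and the removed element determines the letter, which
  gives uniqueness. There are \<open>|\<Delta> \<inter> [x - m, x)|\<close> many \<open>m\<close>-generators and
  \<open>|\<Delta> \<inter> [x, x + n)|\<close> many \<open>n\<close>-cogenerators below \<open>x\<close>, so the parking
  condition says that \<open>\<Delta>\<close> has at least the density on \<open>[x, x + n)\<close> that it has on
  \<open>[x - m, x)\<close>.
\<close>

section \<open>Increasing enumerations\<close>

text \<open>Turns prefixes of the enumeration into initial segments of the set. The list is strictly
  increasing, so comparing entries is the same as comparing indices.\<close>

lemma set_take_sorted_list_of_set:
  fixes A :: "'a::linorder set"
  assumes "finite A" "k < card A"
  shows "set (take k (sorted_list_of_set A)) = {a \<in> A. a < sorted_list_of_set A ! k}"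
proof -
  let ?l = "sorted_list_of_set A"
  have s: "sorted_wrt (<) ?l" by simp
  have len: "length ?l = card A" by simp
  have less_iff: "?l ! i < ?l ! k \<longleftrightarrow> i < k" if "i < card A" for i
    using sorted_wrt_nth_less[OF s] that assms(2) len
    by (metis linorder_neqE_nat order_less_asym)
  have A: "A = (!) ?l ` {..<card A}"
    using assms(1) len by (metis lessThan_atLeast0 nth_image order_refl set_sorted_list_of_set take_all)
  have "set (take k ?l) = (!) ?l ` {..<k}"
    using assms len by (simp add: lessThan_atLeast0 nth_image)
  also have "\<dots> = {a \<in> (!) ?l ` {..<card A}. a < ?l ! k}"
    using less_iff assms(2) by auto
  finally show ?thesis using A by simp
qed

lemma card_less_sorted_list_of_set_nth:
  fixes A :: "'a::linorder set"
  assumes "finite A" "k < card A"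
  shows "card {a \<in> A. a < sorted_list_of_set A ! k} = k"
  using assms by (simp flip: set_take_sorted_list_of_set add: distinct_card)

lemma sorted_list_of_set_nth_mem:
  fixes A :: "'a::linorder set"
  assumes "finite A" "k < card A"
  shows "sorted_list_of_set A ! k \<in> A"
  using assms by (metis length_sorted_list_of_set nth_mem set_sorted_list_of_set)

lemma card_less_mem_less_card:
  fixes A :: "'a::linorder set"
  assumes "finite A" "x \<in> A"
  shows "card {a \<in> A. a < x} < card A"
  using assms by (intro psubset_card_mono) auto

lemma sorted_list_of_set_nth_card_less:
  fixes A :: "'a::linorder set"
  assumes "finite A" "x \<in> A"
  shows "sorted_list_of_set A ! card {a \<in> A. a < x} = x"
proof -
  obtain k where "k < card A" "sorted_list_of_set A ! k = x"
    using assms by (metis in_set_conv_nth length_sorted_list_of_set set_sorted_list_of_set)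
  then show ?thesis using card_less_sorted_list_of_set_nth[OF assms(1)] by metis
qed

section \<open>Counting generators and cogenerators\<close>

text \<open>Invariance is recorded for a single \<open>k\<close> because a letter preserves
  \<open>m\<close>-invariance but may destroy \<open>n\<close>-invariance. \<open>bdd_below\<close>
  takes the place of a minimum since it passes to subsets at once.\<close>

definition semimodule :: "nat \<Rightarrow> int set \<Rightarrow> bool" where
  "semimodule k \<Delta> \<longleftrightarrow> k > 0 \<and> bdd_below \<Delta> \<and> cobounded \<Delta> \<and> invariant k \<Delta>"

lemma invariantD: "invariant k \<Delta> \<Longrightarrow> x \<in> \<Delta> \<Longrightarrow> x + int k \<in> \<Delta>"
  by (auto simp: invariant_def shift_def)

lemma finite_below:
  fixes \<Delta> :: "int set"
  assumes "bdd_below \<Delta>" shows "finite (\<Delta> \<inter> {..<x})"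
proof -
  obtain b where "\<And>y. y \<in> \<Delta> \<Longrightarrow> b \<le> y" using assms by (auto simp: bdd_below_def)
  then have "\<Delta> \<inter> {..<x} \<subseteq> {b..<x}" by auto
  then show ?thesis by (rule finite_subset) simp
qed

text \<open>Adding \<open>k\<close> maps the part of \<Delta> below \<open>x - k\<close> injectively
  into the part below \<open>x\<close>, and the generators below \<open>x\<close> are exactly what
  this map misses. The two parts differ by the window, whence the count.\<close>

lemma card_generators_less:
  assumes "semimodule k \<Delta>"
  shows "card {a \<in> generators k \<Delta>. a < x} = card (\<Delta> \<inter> {x - int k..<x})"
proof -
  have inv: "invariant k \<Delta>" and fin: "finite (\<Delta> \<inter> {..<y})" for y
    using assms finite_below by (auto simp: semimodule_def)
  let ?S = "(\<lambda>y. y + int k) ` (\<Delta> \<inter> {..<x - int k})"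
  have sub: "?S \<subseteq> \<Delta> \<inter> {..<x}" using invariantD[OF inv] by auto
  have cS: "card ?S = card (\<Delta> \<inter> {..<x - int k})"
    by (rule card_image) (auto simp: inj_on_def)
  have mem_S: "a \<in> ?S \<longleftrightarrow> a - int k \<in> \<Delta> \<and> a < x" for a
    by (auto simp: image_iff intro!: bexI[of _ "a - int k"])
  have "{a \<in> generators k \<Delta>. a < x} = \<Delta> \<inter> {..<x} - ?S"
    unfolding set_eq_iff Diff_iff mem_S by (auto simp: generators_def)
  then have "card {a \<in> generators k \<Delta>. a < x} = card (\<Delta> \<inter> {..<x}) - card ?S"
    using sub fin by (simp add: card_Diff_subset finite_subset)
  also have "\<dots> = card (\<Delta> \<inter> {..<x} - \<Delta> \<inter> {..<x - int k})"
    unfolding cS using fin by (subst card_Diff_subset) auto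
  also have "\<Delta> \<inter> {..<x} - \<Delta> \<inter> {..<x - int k} = \<Delta> \<inter> {x - int k..<x}" by auto
  finally show ?thesis .
qed

text \<open>If \<Delta> contains everything from \<open>K\<close> on, all generators lie below
  \<open>K + k\<close>, and the window of length \<open>k\<close> ending there is full.\<close>

lemma finite_card_generators:
  assumes "semimodule k \<Delta>"
  shows "finite (generators k \<Delta>)" "card (generators k \<Delta>) = k"
proof -
  obtain K where K: "{K..} \<subseteq> \<Delta>" using assms by (auto simp: semimodule_def cobounded_def)
  have *: "generators k \<Delta> = {a \<in> generators k \<Delta>. a < K + int k}"
  proof -
    have "a < K + int k" if "a \<in> generators k \<Delta>" for a
      using that K by (rule_tac ccontr) (auto simp: generators_def dest!: subsetD[of _ _ "a - int k"])
    then show ?thesis by auto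
  qed
  have "finite (\<Delta> \<inter> {..<K + int k})" using assms by (simp add: semimodule_def finite_below)
  then show "finite (generators k \<Delta>)"
    by (rule rev_finite_subset) (subst *, auto simp: generators_def)
  have "\<Delta> \<inter> {K + int k - int k..<K + int k} = {K..<K + int k}" using K by auto
  then show "card (generators k \<Delta>) = k"
    using card_generators_less[OF assms, of "K + int k"] * by simp
qed

lemma cogenerators_eq_image: "cogenerators k \<Delta> = (\<lambda>a. a - int k) ` generators k \<Delta>"
proof -
  have "c \<in> (\<lambda>a. a - int k) ` generators k \<Delta>" if "c \<in> cogenerators k \<Delta>" for c
    using that by (intro image_eqI[of _ _ "c + int k"]) (auto simp: cogenerators_def generators_def)
  then show ?thesis by (auto simp: cogenerators_def generators_def)
qed

lemma finite_card_cogenerators: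
  assumes "semimodule k \<Delta>"
  shows "finite (cogenerators k \<Delta>)" "card (cogenerators k \<Delta>) = k"
  using finite_card_generators[OF assms]
  by (auto simp: cogenerators_eq_image card_image inj_on_def)

lemma card_cogenerators_less:
  assumes "semimodule k \<Delta>"
  shows "card {c \<in> cogenerators k \<Delta>. c < x} = card (\<Delta> \<inter> {x..<x + int k})"
proof -
  have "{c \<in> cogenerators k \<Delta>. c < x} = (\<lambda>a. a - int k) ` {a \<in> generators k \<Delta>. a < x + int k}"
    by (auto simp: cogenerators_eq_image)
  then have "card {c \<in> cogenerators k \<Delta>. c < x} = card {a \<in> generators k \<Delta>. a < x + int k}"
    by (simp add: card_image inj_on_def)
  then show ?thesis using card_generators_less[OF assms, of "x + int k"] by simp
qed

lemma sum_shift_int: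
  fixes f :: "int \<Rightarrow> int"
  shows "(\<Sum>y\<in>{a..<b}. f (y + c)) = (\<Sum>y\<in>{a + c..<b + c}. f y)"
  by (rule sum.reindex_bij_witness[of _ "\<lambda>y. y - c" "\<lambda>y. y + c"]) auto

text \<open>
  Summation by parts: with \<open>g\<close> the indicator function of \<open>\<Delta>\<close>, the difference of the two sides is the sum of
  \<open>(y - x + m) (g (y + n) - g y)\<close> over \<open>x - m \<le> y < x\<close> and of
  \<open>(x + n - z) (g z - g (z - m))\<close> over \<open>x \<le> z < x + n\<close>, whose terms are all nonnegative.
\<close>

lemma card_window_le:
  assumes "invariant m \<Delta>" "invariant n \<Delta>"
  shows "n * card (\<Delta> \<inter> {x - int m..<x}) \<le> m * card (\<Delta> \<inter> {x..<x + int n})"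
proof -
  define g :: "int \<Rightarrow> int" where "g y = (if y \<in> \<Delta> then 1 else 0)" for y
  define M N where "M = int m" and "N = int n"
  have gm: "g (y - M) \<le> g y" for y
    using invariantD[OF assms(1), of "y - M"] by (auto simp: g_def M_def)
  have gn: "g y \<le> g (y + N)" for y
    using invariantD[OF assms(2), of y] by (auto simp: g_def N_def)
  have card_g: "int (card (\<Delta> \<inter> {a..<b})) = (\<Sum>y\<in>{a..<b}. g y)" for a b
    by (simp add: g_def sum.If_cases Int_commute)
  \<comment> \<open>The common weight: reindexing \<open>g (y + N)\<close> by
    \<open>w = y + N\<close> and \<open>- g (z - M)\<close> by \<open>w = z - M\<close> gives the
    coefficient \<open>w - N - x + M\<close> in both sums. Their ranges of \<open>w\<close> then
    join to the interval from \<open>x - M\<close> to \<open>x + N\<close>.\<close>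
  let ?h = "\<lambda>w. (w - N - x + M) * g w"
  have split: "(\<Sum>w\<in>{a..<b}. f w) + (\<Sum>w\<in>{b..<c}. f w) = (\<Sum>w\<in>{a..<c}. f w)"
    if "a \<le> b" "b \<le> c" for a b c :: int and f :: "int \<Rightarrow> int"
    using that by (subst sum.union_disjoint[symmetric]) (auto intro!: sum.cong)
  have MN: "M \<ge> 0" "N \<ge> 0" by (auto simp: M_def N_def)
  have "0 \<le> (\<Sum>y\<in>{x - M..<x}. (y - x + M) * (g (y + N) - g y))
    + (\<Sum>z\<in>{x..<x + N}. (x + N - z) * (g z - g (z - M)))"
    by (rule add_nonneg_nonneg; intro sum_nonneg mult_nonneg_nonneg) (simp_all add: gm gn)
  also have "(\<Sum>y\<in>{x - M..<x}. (y - x + M) * (g (y + N) - g y))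
      = (\<Sum>y\<in>{x - M..<x}. ?h (y + N)) - (\<Sum>y\<in>{x - M..<x}. (y - x + M) * g y)"
    by (simp add: algebra_simps flip: sum_subtractf)
  also have "(\<Sum>y\<in>{x - M..<x}. ?h (y + N)) = (\<Sum>w\<in>{x - M + N..<x + N}. ?h w)"
    by (rule sum_shift_int)
  also have "(\<Sum>z\<in>{x..<x + N}. (x + N - z) * (g z - g (z - M)))
      = (\<Sum>z\<in>{x..<x + N}. (x + N - z) * g z) + (\<Sum>z\<in>{x..<x + N}. ?h (z + (- M)))"
    by (simp add: algebra_simps flip: sum.distrib)
  also have "(\<Sum>z\<in>{x..<x + N}. ?h (z + (- M))) = (\<Sum>w\<in>{x - M..<x - M + N}. ?h w)"
    by (subst sum_shift_int) (simp add: algebra_simps)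
  finally have "0 \<le> (\<Sum>w\<in>{x - M..<x + N}. ?h w)
      - (\<Sum>y\<in>{x - M..<x}. (y - x + M) * g y) + (\<Sum>z\<in>{x..<x + N}. (x + N - z) * g z)"
    using split[of "x - M" "x - M + N" "x + N" ?h] MN by linarith
  \<comment> \<open>Cutting the joint range at \<open>x\<close> instead makes the weights constant:
    subtracting \<open>w - x + M\<close> from the one in \<open>?h\<close> leaves \<open>- N\<close>
    on the left, and adding \<open>x + N - w\<close> leaves \<open>M\<close> on the right.\<close>
  also have "(\<Sum>w\<in>{x - M..<x + N}. ?h w)
      = (\<Sum>w\<in>{x - M..<x}. ?h w) + (\<Sum>w\<in>{x..<x + N}. ?h w)"
    using MN by (simp add: split)
  also have "\<dots> - (\<Sum>y\<in>{x - M..<x}. (y - x + M) * g y) + (\<Sum>z\<in>{x..<x + N}. (x + N - z) * g z)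
      = ((\<Sum>w\<in>{x - M..<x}. ?h w) - (\<Sum>y\<in>{x - M..<x}. (y - x + M) * g y))
        + ((\<Sum>w\<in>{x..<x + N}. ?h w) + (\<Sum>z\<in>{x..<x + N}. (x + N - z) * g z))"
    by simp
  also have "\<dots> = (\<Sum>y\<in>{x - M..<x}. - N * g y) + (\<Sum>z\<in>{x..<x + N}. M * g z)"
    unfolding sum_subtractf[symmetric] sum.distrib[symmetric]
    by (intro arg_cong2[of _ _ _ _ "(+)"] sum.cong) (auto simp: algebra_simps)
  also have "\<dots> = M * (\<Sum>z\<in>{x..<x + N}. g z) - N * (\<Sum>y\<in>{x - M..<x}. g y)"
    by (simp add: sum_distrib_left sum_negf)
  finally have "N * int (card (\<Delta> \<inter> {x - M..<x})) \<le> M * int (card (\<Delta> \<inter> {x..<x + N}))"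
    by (simp add: card_g)
  then show ?thesis unfolding M_def N_def by (simp flip: of_nat_mult)
qed

section \<open>The action of letters and words\<close>

lemma generator_list_nth:
  assumes "semimodule m \<Delta>" "j < m"
  shows "generator_list m \<Delta> ! j \<in> generators m \<Delta>"
    and "card {a \<in> generators m \<Delta>. a < generator_list m \<Delta> ! j} = j"
  using assms finite_card_generators[OF assms(1)]
  by (auto simp: generator_list_def sorted_list_of_set_nth_mem card_less_sorted_list_of_set_nth)

lemma letter_act_card_less:
  assumes "semimodule m \<Delta>" "x \<in> generators m \<Delta>"
  shows "letter_act m (card {a \<in> generators m \<Delta>. a < x}) \<Delta> = \<Delta> - {x}"
  using assms finite_card_generators[OF assms(1)]
  by (simp add: letter_act_def generator_list_def sorted_list_of_set_nth_card_less)

text \<open>Only \<open>x - m\<close> could reach \<open>x\<close> by adding \<open>m\<close>, and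
  it is absent because \<open>x\<close> is a generator. Removing \<open>x\<close> may push the
  co-bound up to \<open>x + 1\<close>.\<close>

lemma semimodule_remove_generator:
  assumes "semimodule m \<Delta>" "x \<in> generators m \<Delta>"
  shows "semimodule m (\<Delta> - {x})"
proof -
  obtain K where "{K..} \<subseteq> \<Delta>" using assms by (auto simp: semimodule_def cobounded_def)
  then have "{max K (x + 1)..} \<subseteq> \<Delta> - {x}" by auto
  then show ?thesis
    using assms by (auto simp: semimodule_def cobounded_def invariant_def shift_def generators_def
        intro: bdd_below_mono)
qed

lemma semimodule_letter_act:
  assumes "semimodule m \<Delta>" "j < m" shows "semimodule m (letter_act m j \<Delta>)"
  unfolding letter_act_def
  using assms by (intro semimodule_remove_generator generator_list_nth)

text \<open>The number of generators below a point is a window count, hence monotone under inclusion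
  even though the sets of generators need not be nested.\<close>

lemma generator_list_nth_antimono:
  assumes "semimodule m \<Delta>" "semimodule m \<Delta>'" "\<Delta>' \<subseteq> \<Delta>" "j < m"
  shows "generator_list m \<Delta> ! j \<le> generator_list m \<Delta>' ! j"
proof (rule ccontr)
  let ?y = "generator_list m \<Delta> ! j" and ?x = "generator_list m \<Delta>' ! j"
  assume "\<not> ?y \<le> ?x"
  \<comment> \<open>The bound \<open>?x + 1\<close> makes the count include \<open>?x\<close>
    itself: \<Delta> has at most \<open>j\<close> generators there, while its subset has
    \<open>Suc j\<close>.\<close>
  then have "{a \<in> generators m \<Delta>. a < ?x + 1} \<subseteq> {a \<in> generators m \<Delta>. a < ?y}" by auto
  then have "card {a \<in> generators m \<Delta>. a < ?x + 1} \<le> card {a \<in> generators m \<Delta>. a < ?y}"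
    using finite_card_generators(1)[OF assms(1)] by (intro card_mono) auto
  then have "card (\<Delta> \<inter> {?x + 1 - int m..<?x + 1}) \<le> j"
    using generator_list_nth(2)[OF assms(1,4)] by (simp only: card_generators_less[OF assms(1)])
  moreover have "card (\<Delta>' \<inter> {?x + 1 - int m..<?x + 1}) \<le> card (\<Delta> \<inter> {?x + 1 - int m..<?x + 1})"
    using assms(3) by (intro card_mono) auto
  moreover have "{a \<in> generators m \<Delta>'. a < ?x + 1} = insert ?x {a \<in> generators m \<Delta>'. a < ?x}"
    using generator_list_nth(1)[OF assms(2,4)] by auto
  then have "card {a \<in> generators m \<Delta>'. a < ?x + 1} = Suc j"
    using generator_list_nth(2)[OF assms(2,4)] finite_card_generators(1)[OF assms(2)] by simp
  then have "card (\<Delta>' \<inter> {?x + 1 - int m..<?x + 1}) = Suc j"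
    by (simp only: card_generators_less[OF assms(2)])
  ultimately show False by simp
qed

lemma fold_letter_act_subset: "fold (letter_act m) u \<Delta> \<subseteq> \<Delta>"
  by (induction u arbitrary: \<Delta>) (force simp: letter_act_def)+

text \<open>Every letter removes a generator of index at least \<open>j\<close>, and the generator
  of index \<open>j\<close> can only move up as the set shrinks, so the initial one bounds all
  removed elements from below.\<close>

lemma fold_letter_act_removed_ge:
  assumes "semimodule m \<Delta>" "j < m" "set u \<subseteq> {j..<m}" "x \<in> \<Delta>" "x \<notin> fold (letter_act m) u \<Delta>"
  shows "generator_list m \<Delta> ! j \<le> x"
  using assms
proof (induction u arbitrary: \<Delta>)
  case (Cons l u)
  let ?\<Delta>' = "letter_act m l \<Delta>"
  have l: "j \<le> l" "l < m" using Cons.prems by auto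
  show ?case
  proof (cases "x \<in> ?\<Delta>'")
    case True
    have sm: "semimodule m ?\<Delta>'" using Cons.prems(1) l by (simp add: semimodule_letter_act)
    have "generator_list m ?\<Delta>' ! j \<le> x"
      using Cons.prems True by (intro Cons.IH sm) auto
    moreover have "generator_list m \<Delta> ! j \<le> generator_list m ?\<Delta>' ! j"
      using Cons.prems sm by (intro generator_list_nth_antimono) (auto simp: letter_act_def)
    ultimately show ?thesis by simp
  next
    case False
    then have "x = generator_list m \<Delta> ! l" using Cons.prems by (auto simp: letter_act_def)
    moreover have "sorted (generator_list m \<Delta>)" "length (generator_list m \<Delta>) = m"
      using finite_card_generators[OF Cons.prems(1)] by (auto simp: generator_list_def)
    ultimately show ?thesis using l by (simp add: sorted_nth_mono)
  qed
qed simp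

text \<open>The first letter of a sorted word removes the least element that the whole word removes.\<close>

lemma fold_letter_act_inj:
  assumes "semimodule m \<Delta>" "sorted u" "sorted v" "set u \<subseteq> {..<m}" "set v \<subseteq> {..<m}"
    and "fold (letter_act m) u \<Delta> = fold (letter_act m) v \<Delta>"
  shows "u = v"
proof -
  \<comment> \<open>A nonempty word really changes \<Delta>, which rules out that exactly one of the
    two words is empty.\<close>
  have in_set: "generator_list m \<Delta> ! j \<in> \<Delta>"
    and removed: "generator_list m \<Delta> ! j \<notin> fold (letter_act m) (j # u) \<Delta>"
    if "semimodule m \<Delta>" "j < m" for j u and \<Delta> :: "int set"
    using generator_list_nth(1)[OF that] fold_letter_act_subset[of m u "letter_act m j \<Delta>"]
    by (auto simp: letter_act_def generators_def)
  show ?thesis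
    using assms
  proof (induction u arbitrary: v \<Delta>)
    case Nil
    show ?case
    proof (cases v)
      case (Cons k w)
      then show ?thesis using in_set[of \<Delta> k] removed[of \<Delta> k w] Nil.prems by auto
    qed simp
  next
    case (Cons j u)
    show ?case
    proof (cases v)
      case Nil
      then show ?thesis using in_set[of \<Delta> j] removed[of \<Delta> j u] Cons.prems by auto
    next
      case (Cons k w)
      note prems = Cons.prems[unfolded Cons]
      have jk: "j < m" "k < m" using prems by auto
      \<comment> \<open>The element removed first by \<open>v\<close> is also missing from the
        result of \<open>j # u\<close>, whose letters are all at least \<open>j\<close> by
        sortedness. The opposite inequality is symmetric.\<close>
      have "generator_list m \<Delta> ! j \<le> generator_list m \<Delta> ! k"
        using prems jk in_set[OF prems(1) jk(2)] removed[OF prems(1) jk(2), of w]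
        by (intro fold_letter_act_removed_ge[of m \<Delta> j "j # u"]) auto
      moreover have "generator_list m \<Delta> ! k \<le> generator_list m \<Delta> ! j"
        using prems jk in_set[OF prems(1) jk(1)] removed[OF prems(1) jk(1), of u]
        by (intro fold_letter_act_removed_ge[of m \<Delta> k "k # w"]) auto
      ultimately have "j = k" using generator_list_nth(2)[OF prems(1)] jk by (metis antisym)
      moreover have "u = w"
        using prems \<open>j = k\<close> jk by (intro Cons.IH[of "letter_act m j \<Delta>"] semimodule_letter_act) auto
      ultimately show ?thesis using Cons by simp
    qed
  qed
qed

lemma mem_shift: "y \<in> shift n \<Delta> \<longleftrightarrow> y - int n \<in> \<Delta>"
  unfolding shift_def by (auto simp: image_iff intro!: bexI[of _ "y - int n"])

lemma generators_shift: "a \<in> generators m (shift n \<Delta>) \<longleftrightarrow> a - int n \<in> generators m \<Delta>"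
  by (simp add: generators_def mem_shift algebra_simps)

text \<open>\<open>R i\<close> collects the first \<open>i\<close> removed elements. Carrying
  \<open>semimodule\<close> through the induction guarantees that there are \<open>m\<close>
  generators at each stage, so that letters and ranks correspond.\<close>

lemma fold_letter_act_cogenerators:
  fixes \<Delta> :: "int set" and m n :: nat
  assumes "semimodule m \<Delta>" "semimodule n \<Delta>" "i \<le> n"
  defines "q \<equiv> map (\<lambda>c. card {a \<in> generators m \<Delta>. a < c}) (cogenerator_list n \<Delta>)"
  defines "R \<equiv> \<lambda>i. (\<lambda>c. c + int n) ` set (take i (cogenerator_list n \<Delta>))"
  shows "semimodule m (\<Delta> - R i) \<and> fold (letter_act m) (take i q) \<Delta> = \<Delta> - R i"
  using assms(3)
proof (induction i)
  case 0
  then show ?case using assms(1) by (simp add: R_def)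
next
  case (Suc i)
  let ?cl = "cogenerator_list n \<Delta>"
  let ?\<Delta>' = "\<Delta> - R i"
  have fc: "finite (cogenerators n \<Delta>)" "card (cogenerators n \<Delta>) = n"
    using finite_card_cogenerators assms(2) by auto
  have i: "i < n" using Suc by simp
  define c where "c = ?cl ! i"
  have len: "length ?cl = n" using fc by (simp add: cogenerator_list_def)
  have sm: "semimodule m ?\<Delta>'" and fold: "fold (letter_act m) (take i q) \<Delta> = ?\<Delta>'"
    using Suc by auto
  have c: "c \<notin> \<Delta>" "c + int n \<in> \<Delta>"
    using sorted_list_of_set_nth_mem[OF fc(1), of i] i fc
    by (auto simp: c_def cogenerator_list_def cogenerators_def)
  have R: "R i = (\<lambda>c. c + int n) ` {d \<in> cogenerators n \<Delta>. d < c}"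
    using set_take_sorted_list_of_set[OF fc(1), of i] i fc
    by (simp add: R_def c_def cogenerator_list_def)
  have mem_R: "y \<in> R i \<longleftrightarrow> y \<in> \<Delta> \<and> y - int n \<notin> \<Delta> \<and> y < c + int n" for y
    unfolding R by (auto simp: cogenerators_def image_iff intro!: exI[of _ "y - int n"])
  \<comment> \<open>Below \<open>c + n\<close>, \<open>R i\<close> contains precisely the elements
    of \<Delta> that are not in its shift.\<close>
  have agree: "y \<in> ?\<Delta>' \<longleftrightarrow> y \<in> shift n \<Delta>" if "y < c + int n" for y
    using that invariantD[of n \<Delta> "y - int n"] assms(2)
    by (auto simp: mem_R mem_shift semimodule_def)
  \<comment> \<open>Otherwise \<open>m\<close>-invariance would put \<open>c\<close> into \<Delta>.
    Hence \<open>c + n - m\<close> is not in the shift and, lying below \<open>c + n\<close>, not in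
    the current set either.\<close>
  have "c - int m \<notin> \<Delta>" using c(1) invariantD[of m \<Delta> "c - int m"] assms(1)
    by (auto simp: semimodule_def)
  then have gen: "c + int n \<in> generators m ?\<Delta>'"
    using c assms(1) by (auto simp: generators_def mem_R agree semimodule_def mem_shift algebra_simps)
  \<comment> \<open>Being a generator depends only on the membership of \<open>a\<close> and
    \<open>a - m\<close>, both below \<open>c + n\<close>, where the two sets agree.\<close>
  have "{a \<in> generators m ?\<Delta>'. a < c + int n} = {a \<in> generators m (shift n \<Delta>). a < c + int n}"
  proof -
    have "a \<in> generators m ?\<Delta>' \<longleftrightarrow> a \<in> generators m (shift n \<Delta>)" if "a < c + int n" for a
      using agree[of a] agree[of "a - int m"] that unfolding generators_def by auto
    then show ?thesis by blast
  qed
  also have "\<dots> = (\<lambda>a. a + int n) ` {a \<in> generators m \<Delta>. a < c}"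
    by (auto simp: generators_shift image_iff intro!: exI[of _ "_ - int n"])
  finally have "card {a \<in> generators m ?\<Delta>'. a < c + int n} = q ! i"
    using i len by (simp add: card_image inj_on_def q_def c_def)
  then have act: "letter_act m (q ! i) ?\<Delta>' = ?\<Delta>' - {c + int n}"
    using letter_act_card_less[OF sm gen] by simp
  have Suc_R: "\<Delta> - R (Suc i) = ?\<Delta>' - {c + int n}"
    using i len by (auto simp: R_def c_def take_Suc_conv_app_nth)
  have "fold (letter_act m) (take (Suc i) q) \<Delta> = letter_act m (q ! i) ?\<Delta>'"
    using fold i len by (simp add: q_def take_Suc_conv_app_nth)
  then show ?case
    using act Suc_R semimodule_remove_generator[OF sm gen] by simp
qed

section \<open>The lattice path\<close>

lemma length_path_vertices [simp]: "length (path_vertices P ss) = Suc (length ss)"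
  by (induction P ss rule: path_vertices.induct) auto

lemma path_vertices_nth:
  assumes "k \<le> length ss"
  shows "path_vertices P ss ! k =
    (fst P - int (count_list (take k ss) Left), snd P + count_list (take k ss) Up)"
  using assms
proof (induction P ss arbitrary: k rule: path_vertices.induct)
  case (2 x y ss)
  then show ?case by (cases k) auto
next
  case (3 x y ss)
  then show ?case by (cases k) auto
qed auto

lemma count_list_map_step:
  assumes "distinct xs"
  shows "count_list (map (\<lambda>s. if s \<in> G then Up else Left) xs) Up = card (set xs \<inter> G)"
    and "count_list (map (\<lambda>s. if s \<in> G then Up else Left) xs) Left = card (set xs - G)"
  using assms by (induction xs) (auto simp: insert_Diff_if)

text \<open>Generators lie in \<Delta> and cogenerators outside it, so no skeleton element is
  counted for both coordinates.\<close>

lemma skeleton_path_nth: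
  assumes sm: "semimodule m \<Delta>" "semimodule n \<Delta>" and k: "k \<le> m + n"
  shows "length (skeleton_list m n \<Delta>) = m + n"
    and "length (skeleton_path m n \<Delta>) = Suc (m + n)"
    and "skeleton_path m n \<Delta> ! k =
      (int n - int (card (set (take k (skeleton_list m n \<Delta>)) \<inter> cogenerators n \<Delta>)),
       card (set (take k (skeleton_list m n \<Delta>)) \<inter> generators m \<Delta>))"
proof -
  note fin = finite_card_generators[OF sm(1)] finite_card_cogenerators[OF sm(2)]
  have disj: "generators m \<Delta> \<inter> cogenerators n \<Delta> = {}"
    by (auto simp: generators_def cogenerators_def)
  then show len: "length (skeleton_list m n \<Delta>) = m + n"
    using fin by (simp add: skeleton_list_def skeleton_def card_Un_disjoint)
  then show "length (skeleton_path m n \<Delta>) = Suc (m + n)" by (simp add: skeleton_path_def)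
  have sub: "set (take k (skeleton_list m n \<Delta>)) \<subseteq> generators m \<Delta> \<union> cogenerators n \<Delta>"
    using set_take_subset[of k "skeleton_list m n \<Delta>"] fin
    by (simp add: skeleton_list_def skeleton_def)
  have minus: "set (take k (skeleton_list m n \<Delta>)) - generators m \<Delta>
      = set (take k (skeleton_list m n \<Delta>)) \<inter> cogenerators n \<Delta>"
    using sub disj by blast
  have dist: "distinct (take k (skeleton_list m n \<Delta>))" by (simp add: skeleton_list_def)
  show "skeleton_path m n \<Delta> ! k =
      (int n - int (card (set (take k (skeleton_list m n \<Delta>)) \<inter> cogenerators n \<Delta>)),
       card (set (take k (skeleton_list m n \<Delta>)) \<inter> generators m \<Delta>))"
    unfolding skeleton_path_def using k len
    by (subst path_vertices_nth) (simp_all add: take_map count_list_map_step[OF dist] minus)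
qed

lemma last_skeleton_path:
  assumes "semimodule m \<Delta>" "semimodule n \<Delta>"
  shows "last (skeleton_path m n \<Delta>) = (0, m)"
proof -
  note path = skeleton_path_nth[OF assms order_refl]
  note fin = finite_card_generators[OF assms(1)] finite_card_cogenerators[OF assms(2)]
  have "set (skeleton_list m n \<Delta>) = generators m \<Delta> \<union> cogenerators n \<Delta>"
    using fin by (simp add: skeleton_list_def skeleton_def)
  then have "skeleton_path m n \<Delta> ! (m + n) = (0, m)"
    using path fin by (simp add: Int_absorb1)
  moreover have "skeleton_path m n \<Delta> \<noteq> []" using path(2) by auto
  ultimately show ?thesis using path(2) by (simp add: last_conv_nth)
qed

text \<open>The index \<open>k\<close> is the rank of \<open>c\<close> in the skeleton, so the first
  \<open>k\<close> steps come from the elements below \<open>c\<close>. Both ends of the step are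
  given: the first yields its height, the pair yields the column it crosses.\<close>

lemma skeleton_path_cogenerator:
  assumes sm: "semimodule m \<Delta>" "semimodule n \<Delta>" and c: "c \<in> cogenerators n \<Delta>"
  obtains k where "k < m + n" "skeleton_list m n \<Delta> ! k = c"
    and "skeleton_path m n \<Delta> ! k =
      (int n - int (card {d \<in> cogenerators n \<Delta>. d < c}), card {a \<in> generators m \<Delta>. a < c})"
    and "skeleton_path m n \<Delta> ! Suc k =
      (int n - int (card {d \<in> cogenerators n \<Delta>. d < c}) - 1, card {a \<in> generators m \<Delta>. a < c})"
proof -
  note fin = finite_card_generators[OF sm(1)] finite_card_cogenerators[OF sm(2)]
  let ?S = "skeleton m n \<Delta>" and ?l = "skeleton_list m n \<Delta>"
  have finS: "finite ?S" using fin by (simp add: skeleton_def)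
  have cS: "c \<in> ?S" using c by (simp add: skeleton_def)
  have cG: "c \<notin> generators m \<Delta>" using c by (auto simp: cogenerators_def generators_def)
  have len: "length ?l = m + n" by (rule skeleton_path_nth(1)[OF sm order_refl])
  define k where "k = card {a \<in> ?S. a < c}"
  have k: "k < m + n"
    using card_less_mem_less_card[OF finS cS] len by (simp add: k_def skeleton_list_def)
  have nth: "?l ! k = c"
    using sorted_list_of_set_nth_card_less[OF finS cS] by (simp add: k_def skeleton_list_def)
  have take_k: "set (take k ?l) = {a \<in> ?S. a < c}"
    using set_take_sorted_list_of_set[OF finS] k len nth by (simp add: skeleton_list_def)
  have take_Suc_k: "set (take (Suc k) ?l) = insert c {a \<in> ?S. a < c}"
    using k len nth take_k by (simp add: take_Suc_conv_app_nth)
  have eqs: "{a \<in> ?S. a < c} \<inter> cogenerators n \<Delta> = {d \<in> cogenerators n \<Delta>. d < c}"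
    "{a \<in> ?S. a < c} \<inter> generators m \<Delta> = {a \<in> generators m \<Delta>. a < c}"
    by (auto simp: skeleton_def)
  show thesis
  proof (rule that[OF k nth])
    show "skeleton_path m n \<Delta> ! k =
      (int n - int (card {d \<in> cogenerators n \<Delta>. d < c}), card {a \<in> generators m \<Delta>. a < c})"
      using skeleton_path_nth(3)[OF sm, of k] k by (simp add: take_k eqs)
    show "skeleton_path m n \<Delta> ! Suc k =
      (int n - int (card {d \<in> cogenerators n \<Delta>. d < c}) - 1, card {a \<in> generators m \<Delta>. a < c})"
      using skeleton_path_nth(3)[OF sm, of "Suc k"] k c cG fin by (simp add: take_Suc_k eqs)
  qed
qed

lemma step_height_eq:
  assumes "semimodule m \<Delta>" "semimodule n \<Delta>" "c \<in> cogenerators n \<Delta>"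
  shows "step_height m n \<Delta> c = card {a \<in> generators m \<Delta>. a < c}"
proof -
  obtain k where k: "k < m + n" "skeleton_list m n \<Delta> ! k = c"
    "skeleton_path m n \<Delta> ! k =
      (int n - int (card {d \<in> cogenerators n \<Delta>. d < c}), card {a \<in> generators m \<Delta>. a < c})"
    by (rule skeleton_path_cogenerator[OF assms])
  have len: "length (skeleton_list m n \<Delta>) = m + n"
    by (rule skeleton_path_nth(1)[OF assms(1,2) order_refl])
  have dist: "distinct (skeleton_list m n \<Delta>)" by (simp add: skeleton_list_def)
  have "(THE k. k < length (skeleton_list m n \<Delta>) \<and> skeleton_list m n \<Delta> ! k = c) = k"
    using k len nth_eq_iff_index_eq[OF dist] by (intro the_equality) auto
  then show ?thesis by (simp add: step_height_def k(3))
qed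

section \<open>Heights, parking condition, action and uniqueness\<close>

theorem theorem1p2:
  fixes m n :: nat and \<Delta> :: "int set"
  assumes "m > 0" and "n > 0"
    and "has_minimum \<Delta>" and "cobounded \<Delta>"
    and "invariant m \<Delta>" and "invariant n \<Delta>"
  defines "p \<equiv> height_word m n \<Delta>"
  shows "last (skeleton_path m n \<Delta>) = (0, m)
    \<and> length (cogenerator_list n \<Delta>) = n
    \<and> (\<forall>i<n. rev p ! i = card {a \<in> generators m \<Delta>. a < cogenerator_list n \<Delta> ! i})
    \<and> (\<forall>x<n. column_height (skeleton_path m n \<Delta>) x (p ! x))
    \<and> parking_function m n p \<and> monotone_word p \<and> word_act m p \<Delta> = shift n \<Delta>
    \<and> (\<forall>w. parking_function m n w \<and> monotone_word w \<and> word_act m w \<Delta> = shift n \<Delta> \<longrightarrow> w = p)"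
proof -
  let ?cl = "cogenerator_list n \<Delta>"
  define rk where "rk c = card {a \<in> generators m \<Delta>. a < c}" for c
  have "bdd_below \<Delta>" using assms(3) by (auto simp: has_minimum_def bdd_below_def)
  then have sm: "semimodule m \<Delta>" "semimodule n \<Delta>" using assms by (auto simp: semimodule_def)
  note fG = finite_card_generators[OF sm(1)] and fC = finite_card_cogenerators[OF sm(2)]
  have len: "length ?cl = n" using fC by (simp add: cogenerator_list_def)
  have set_cl: "set ?cl = cogenerators n \<Delta>" using fC by (simp add: cogenerator_list_def)
  have p: "rev p = map rk ?cl"
    by (simp add: p_def height_word_def rk_def step_height_eq[OF sm] set_cl)
  have heights: "rev p ! i = rk (?cl ! i)" if "i < n" for i using that len by (simp add: p)
  have len_p: "length p = n" using p len by (metis length_map length_rev)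

  have column: "column_height (skeleton_path m n \<Delta>) x (p ! x)" if x: "x < n" for x
  proof -
    \<comment> \<open>The word is read from left to right but the path runs from right to left: the
      column from \<open>x\<close> to \<open>x + 1\<close> is crossed by the step of
      \<open>c\<close> with index \<open>n - 1 - x\<close>, which starts at abscissa
      \<open>n - i = x + 1\<close>.\<close>
    define i where "i = n - Suc x"
    have i: "i < n" "x = n - Suc i" using x by (auto simp: i_def)
    have "p ! x = rk (?cl ! i)"
      using heights[OF i(1)] i x len_p by (simp add: rev_nth)
    moreover have "?cl ! i \<in> cogenerators n \<Delta>" using i len set_cl by (metis nth_mem)
    moreover have "card {d \<in> cogenerators n \<Delta>. d < ?cl ! i} = i"
      using card_less_sorted_list_of_set_nth[OF fC(1), of i] fC i by (simp add: cogenerator_list_def)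
    ultimately obtain k where "k < m + n"
      "skeleton_path m n \<Delta> ! k = (int n - int i, p ! x)"
      "skeleton_path m n \<Delta> ! Suc k = (int n - int i - 1, p ! x)"
      using skeleton_path_cogenerator[OF sm] by (metis rk_def)
    moreover have "length (skeleton_path m n \<Delta>) = Suc (m + n)"
      by (rule skeleton_path_nth(2)[OF sm order_refl])
    ultimately show ?thesis unfolding column_height_def using i by (intro exI[of _ k]) auto
  qed

  have mono: "monotone_word p"
  proof -
    have "mono rk" unfolding rk_def mono_def using fG by (auto intro!: card_mono)
    moreover have "sorted ?cl" by (simp add: cogenerator_list_def)
    ultimately show ?thesis
      unfolding monotone_word_def p sorted_map
      by (auto simp: mono_def elim: sorted_wrt_mono_rel[rotated])
  qed

  \<comment> \<open>Turns a bound on letters into a cutoff on cogenerators. The generator at index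
    \<open>i - 1\<close> has rank \<open>i - 1\<close>, and the added \<open>1\<close> gives the
    strict form that the counting lemmas use.\<close>
  have less_iff: "rk c < i \<longleftrightarrow> c < generator_list m \<Delta> ! (i - 1) + 1"
    if c: "c \<in> cogenerators n \<Delta>" and i: "i \<in> {1..m}" for c i
  proof -
    let ?a = "generator_list m \<Delta> ! (i - 1)"
    have a: "?a \<in> generators m \<Delta>" "rk ?a = i - 1"
      using generator_list_nth[OF sm(1), of "i - 1"] i by (auto simp: rk_def)
    have "rk c \<le> rk ?a" if "c \<le> ?a"
      unfolding rk_def using that fG by (intro card_mono) auto
    moreover have "rk ?a < rk c" if "?a < c"
      unfolding rk_def using that fG a by (intro psubset_card_mono) auto
    ultimately show ?thesis using a i by force
  qed

  have parking: "parking_function m n p"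
    unfolding parking_function_def
  proof (intro conjI ballI)
    show "length p = n" by fact
    \<comment> \<open>If all \<open>m\<close> generators were below \<open>c\<close>, the window of
      length \<open>m\<close> before \<open>c\<close> would be full; then \<open>c - m\<close> would
      be in \<Delta> and so would \<open>c\<close>.\<close>
    have "rk c < m" if "c \<in> cogenerators n \<Delta>" for c
    proof -
      have "c < generator_list m \<Delta> ! (m - 1) + 1"
      proof (rule ccontr)
        assume "\<not> ?thesis"
        then have "rk c = m"
          using less_iff[OF that, of m] assms(1) card_mono[OF fG(1), of "{a \<in> generators m \<Delta>. a < c}"] fG
          by (auto simp: rk_def)
        then have "card (\<Delta> \<inter> {c - int m..<c}) = card {c - int m..<c}"
          using card_generators_less[OF sm(1)] by (simp add: rk_def)
        then have "\<Delta> \<inter> {c - int m..<c} = {c - int m..<c}"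
          by (intro card_subset_eq) auto
        moreover have "c - int m \<in> {c - int m..<c}" using assms(1) by simp
        ultimately have "c - int m \<in> \<Delta>" by blast
        then show False using invariantD[OF assms(5), of "c - int m"] that by (simp add: cogenerators_def)
      qed
      then show ?thesis using less_iff[OF that, of m] assms(1) by auto
    qed
    moreover have "set p = rk ` cogenerators n \<Delta>" using p set_cl by (metis set_map set_rev)
    ultimately show "set p \<subseteq> {..<m}" by auto
  next
    fix i assume i: "i \<in> {1..m}"
    let ?a = "generator_list m \<Delta> ! (i - 1)"
    have a: "?a \<in> generators m \<Delta>" "card {b \<in> generators m \<Delta>. b < ?a} = i - 1"
      using generator_list_nth[OF sm(1), of "i - 1"] i by auto
    \<comment> \<open>Indices of letters below \<open>i\<close> correspond to cogenerators below the
      cutoff, whose number is a window count.\<close>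
    have "bij_betw ((!) ?cl) {j. j < n \<and> rev p ! j < i} {c \<in> cogenerators n \<Delta>. c < ?a + 1}"
    proof (rule bij_betwI')
      fix x y assume "x \<in> {j. j < n \<and> rev p ! j < i}" "y \<in> {j. j < n \<and> rev p ! j < i}"
      then show "(?cl ! x = ?cl ! y) = (x = y)"
        using len by (auto simp: nth_eq_iff_index_eq cogenerator_list_def)
    next
      fix x assume x: "x \<in> {j. j < n \<and> rev p ! j < i}"
      then have "?cl ! x \<in> cogenerators n \<Delta>" using len set_cl by (metis mem_Collect_eq nth_mem)
      then show "?cl ! x \<in> {c \<in> cogenerators n \<Delta>. c < ?a + 1}"
        using x less_iff[OF _ i] heights by (metis (mono_tags, lifting) mem_Collect_eq)
    next
      fix c assume c: "c \<in> {c \<in> cogenerators n \<Delta>. c < ?a + 1}"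
      then obtain j where "j < n" "?cl ! j = c"
        using set_cl len by (metis in_set_conv_nth mem_Collect_eq)
      then show "\<exists>x\<in>{j. j < n \<and> rev p ! j < i}. c = ?cl ! x"
        using c less_iff[OF _ i] heights by auto
    qed
    then have D: "card {j. j < n \<and> rev p ! j < i} = card (\<Delta> \<inter> {?a + 1..<?a + 1 + int n})"
      unfolding card_cogenerators_less[OF sm(2), symmetric] by (rule bij_betw_same_card)
    \<comment> \<open>Exactly \<open>i\<close> generators lie below \<open>?a + 1\<close>, so the
      window inequality at this point is the parking condition for \<open>i\<close>.\<close>
    have "{b \<in> generators m \<Delta>. b < ?a + 1} = insert ?a {b \<in> generators m \<Delta>. b < ?a}"
      using a by auto
    then have "card {b \<in> generators m \<Delta>. b < ?a + 1} = i" using a fG i by simp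
    then have "card (\<Delta> \<inter> {?a + 1 - int m..<?a + 1}) = i"
      by (simp only: card_generators_less[OF sm(1)])
    then have "n * i \<le> m * card {j. j < n \<and> rev p ! j < i}"
      using card_window_le[OF assms(5,6), of "?a + 1"] D by simp
    then have "real n * real i \<le> real m * real (card {j. j < n \<and> rev p ! j < i})"
      by (metis of_nat_le_iff of_nat_mult)
    then show "real i * real n / real m \<le> real (card {j. j < n \<and> rev p ! j < i})"
      using assms(1) by (simp add: divide_le_eq mult.commute)
  qed

  have word: "word_act m w \<Delta> = fold (letter_act m) (rev w) \<Delta>" for w
    by (simp add: word_act_def foldr_conv_fold)
  have act: "word_act m p \<Delta> = shift n \<Delta>"
  proof -
    have "fold (letter_act m) (rev p) \<Delta> = \<Delta> - (\<lambda>c. c + int n) ` cogenerators n \<Delta>"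
      using fold_letter_act_cogenerators[OF sm order_refl] len p
      by (simp add: rk_def[abs_def] set_cl)
    \<comment> \<open>The elements \<open>c + n\<close> are the \<open>n\<close>-generators, and an
      element of \<Delta> that is not an \<open>n\<close>-generator is one with \<open>y - n\<close>
      in \<Delta>.\<close>
    also have "\<dots> = \<Delta> - generators n \<Delta>" by (simp add: cogenerators_eq_image image_image)
    also have "\<dots> = shift n \<Delta>"
      using invariantD[OF assms(6), of "_ - int n"] by (force simp: generators_def mem_shift)
    finally show ?thesis by (simp add: word)
  qed

  have uniq: "w = p"
    if "parking_function m n w" "monotone_word w" "word_act m w \<Delta> = shift n \<Delta>" for w
    using fold_letter_act_inj[OF sm(1), of "rev w" "rev p"] that mono parking act
    by (auto simp: monotone_word_def parking_function_def word)

  show ?thesis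
    using last_skeleton_path[OF sm] len heights column parking mono act uniq
    unfolding rk_def by blast
qed

end
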